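(* Let $\Gamma$ be a weighted multidigraph on the vertex set $V=\{1,\dots,n\}$ with Kirchhoff matrix $L=L(\Gamma)$, and let $W=I+L$. For any $i,j\in V$, the cofactor $W^{ij}$ of the $(i,j)$-entry of $W$ satisfies $W^{ij}=\varepsilon(\mathcal{F}^{i\to j})$. Here $\mathcal{F}^{i\to j}$ is the set of spanning diverging forests of $\Gamma$ in which $i$ and $j$ belong to the same tree and that tree diverges from (is rooted at) $i$.
   Context: A weighted multidigraph $\Gamma$ on $V=\{1,\dots,n\}$ may have several arcs from $i$ to $j$. Each arc carries a real weight, which may be negative. The Kirchhoff matrix $L=(\ell_{ij})$ has $\ell_{ij}=-(\text{sum of the weights of all arcs from } j \text{ to } i)$ for $i\neq j$, and $\ell_{ii}=-\sum_{j\neq i}\ell_{ij}$. The cofactor $W^{ij}$ is $(-1)^{i+j}$ times the determinant of the matrix obtained from $W$ by deleting row $i$ and column $j$. A diverging tree is a directed tree (one whose underlying undirected graph is a tree) with a marked root, containing a directed path from the root to every other vertex. A spanning diverging forest of $\Gamma$ is a spanning subgraph that is a directed forest each of whose components is a diverging tree with its root marked. The weight $\varepsilon(H)$ of a subgraph is the product of its arc weights, and is $1$ if it has no arcs. For a nonempty set of subgraphs, $\varepsilon$ is the sum of the weights of its members; the empty set has weight $0$. *)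

theory Defs
  imports "Graph_Theory.Graph_Theory" "Jordan_Normal_Form.Determinant"
begin

text \<open>
  The library predicates \<open>forest\<close> and \<open>tree\<close> of Graph_Theory only forbid directed cycles, so
  that, for example, the transitive tournament on three vertices is a \<open>tree\<close> in that sense.
  Here the underlying undirected multigraph has to be acyclic.  It is represented by replacing
  each arc \<open>e\<close> by the two arcs \<open>(e, False)\<close> and \<open>(e, True)\<close>, directed like \<open>e\<close> and against \<open>e\<close>;
  an undirected cycle is a cycle that uses no edge \<open>e\<close> twice.  Thus a loop is an undirected
  cycle, and so is a pair of arcs with the same two end vertices, in whichever directions.
\<close>

definition underlying :: "('a, 'b) pre_digraph \<Rightarrow> ('a, 'b \<times> bool) pre_digraph" where
  "underlying G =
    \<lparr> verts = verts G, arcs = arcs G \<times> UNIV,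
      tail = (\<lambda>(e, b). if b then head G e else tail G e),
      head = (\<lambda>(e, b). if b then tail G e else head G e) \<rparr>"

definition undirected_cycle :: "('a, 'b) pre_digraph \<Rightarrow> ('b \<times> bool) awalk \<Rightarrow> bool" where
  "undirected_cycle G p \<longleftrightarrow> pre_digraph.cycle (underlying G) p \<and> distinct (map fst p)"

definition directed_forest :: "('a, 'b) pre_digraph \<Rightarrow> bool" where
  "directed_forest G \<longleftrightarrow> wf_digraph G \<and> (\<nexists>p. undirected_cycle G p)"

text \<open>\<open>Digraph_Component.connected\<close> is weak connectedness and requires at least one vertex.\<close>

definition directed_tree :: "('a, 'b) pre_digraph \<Rightarrow> bool" where
  "directed_tree G \<longleftrightarrow> directed_forest G \<and> Digraph_Component.connected G"

definition diverging_tree :: "('a, 'b) pre_digraph \<Rightarrow> 'a \<Rightarrow> bool" where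
  "diverging_tree T r \<longleftrightarrow>
     directed_tree T \<and> r \<in> verts T \<and> (\<forall>v \<in> verts T. \<exists>p. pre_digraph.apath T r p v)"

definition components :: "('a, 'b) pre_digraph \<Rightarrow> ('a, 'b) pre_digraph set" where
  "components G = {C. pre_digraph.max_subgraph G Digraph_Component.connected C}"

text \<open>A diverging forest is a digraph together with the set \<open>R\<close> of its marked roots.\<close>

definition diverging_forest :: "('a, 'b) pre_digraph \<Rightarrow> 'a set \<Rightarrow> bool" where
  "diverging_forest H R \<longleftrightarrow>
     directed_forest H \<and> R \<subseteq> verts H \<and>
     (\<forall>C \<in> components H. \<exists>r. R \<inter> verts C = {r} \<and> diverging_tree C r)"

definition spanning_diverging_forests ::
    "('a, 'b) pre_digraph \<Rightarrow> (('a, 'b) pre_digraph \<times> 'a set) set" where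
  "spanning_diverging_forests G = {(H, R). spanning H G \<and> diverging_forest H R}"

definition forests_from_to ::
    "('a, 'b) pre_digraph \<Rightarrow> 'a \<Rightarrow> 'a \<Rightarrow> (('a, 'b) pre_digraph \<times> 'a set) set" where
  "forests_from_to G i j =
     {(H, R) \<in> spanning_diverging_forests G.
        \<exists>C \<in> components H. i \<in> verts C \<and> j \<in> verts C \<and> R \<inter> verts C = {i}}"

definition subgraph_weight :: "'b weight_fun \<Rightarrow> ('a, 'b) pre_digraph \<Rightarrow> real" where
  "subgraph_weight w H = (\<Prod>e \<in> arcs H. w e)"

definition family_weight ::
    "'b weight_fun \<Rightarrow> (('a, 'b) pre_digraph \<times> 'a set) set \<Rightarrow> real" where
  "family_weight w \<F> = (\<Sum>(H, R) \<in> \<F>. subgraph_weight w H)"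

definition total_weight ::
    "'b weight_fun \<Rightarrow> ('a, 'b) pre_digraph \<Rightarrow> 'a \<Rightarrow> 'a \<Rightarrow> real" where
  "total_weight w G u v = (\<Sum>e | e \<in> arcs G \<and> tail G e = u \<and> head G e = v. w e)"

text \<open>The \<open>(i, j)\<close>-entry comes from the arcs from \<open>j\<close> to \<open>i\<close>.\<close>

definition kirchhoff_entry ::
    "'b weight_fun \<Rightarrow> ('a, 'b) pre_digraph \<Rightarrow> 'a \<Rightarrow> 'a \<Rightarrow> real" where
  "kirchhoff_entry w G i j =
     (if i \<noteq> j then - total_weight w G j i
      else - (\<Sum>k \<in> verts G - {i}. - total_weight w G k i))"

text \<open>
  Vertices are \<open>1, \<dots>, n\<close>, but matrix indices start at 0: row and column \<open>i - 1\<close> belong to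
  vertex \<open>i\<close>.  The shift does not affect the sign in \<open>cofactor\<close>, as both indices drop by 1.
\<close>

definition kirchhoff_mat :: "'b weight_fun \<Rightarrow> (nat, 'b) pre_digraph \<Rightarrow> real mat" where
  "kirchhoff_mat w G =
     mat (card (verts G)) (card (verts G)) (\<lambda>(i, j). kirchhoff_entry w G (Suc i) (Suc j))"

end

theory Submission
  imports Defs
begin

text \<open>
  The cofactor is the determinant of \<open>W\<close> with row \<open>i\<close> replaced by the unit row vector \<open>e\<^sub>j\<close>.
  Every other row \<open>v\<close> of \<open>W\<close> is \<open>e\<^sub>v\<close> plus the sum of \<open>\<epsilon>(a) (e\<^sub>v - e\<^sub>u)\<close> over the arcs \<open>a\<close> from \<open>u\<close>
  to \<open>v\<close>, so multilinearity expands the determinant over all ways of choosing, for each vertex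
  \<open>v \<noteq> i\<close>, either one incoming arc or none.  The determinant attached to a choice is 1 if following
  the chosen arcs backwards always ends at a vertex without a chosen arc, and leads from \<open>j\<close> to \<open>i\<close>;
  otherwise the indicator function of a suitable set of vertices lies in the kernel, and the
  determinant is 0.  The choices that survive are exactly the diverging forests in question: a
  digraph is a diverging forest if and only if no root has an incoming arc, no vertex has two, and
  every vertex is reachable from a root.
\<close>

section \<open>Determinants of parent-pointer matrices\<close>

text \<open>The rank is the least number of steps to a terminal element. As \<open>p\<close> is a
  function, the first step from \<open>a\<close> must go to \<open>b\<close>, so \<open>b\<close> is
  closer.\<close>

lemma ex_rank_if_all_terminate:
  fixes p :: "'a \<Rightarrow> 'a option"
  defines "E \<equiv> {(a, b). p a = Some b}"
  assumes "\<And>a. \<exists>r. p r = None \<and> (a, r) \<in> E\<^sup>*"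
  obtains f :: "'a \<Rightarrow> nat" where "\<And>a b. p a = Some b \<Longrightarrow> f b < f a"
proof -
  define P where "P a k \<longleftrightarrow> (\<exists>r. p r = None \<and> (a, r) \<in> E ^^ k)" for a k
  have ex: "\<exists>k. P a k" for a
    using assms(2)[of a] by (auto simp: P_def rtrancl_power)
  have "(LEAST k. P b k) < (LEAST k. P a k)" if "p a = Some b" for a b
  proof -
    define k where "k = (LEAST k. P a k)"
    have "P a k" unfolding k_def using ex by (rule LeastI_ex)
    then obtain r where r: "p r = None" "(a, r) \<in> E ^^ k" by (auto simp: P_def)
    with that have "k \<noteq> 0" by (cases k) auto
    then obtain l where l: "k = Suc l" by (cases k) auto
    with r obtain c where "(a, c) \<in> E" "(c, r) \<in> E ^^ l"
      by (blast elim: relpow_Suc_E2)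
    with that r have "P b l" by (auto simp: E_def P_def)
    then have "(LEAST k. P b k) \<le> l" by (rule Least_le)
    then show ?thesis using l by (simp add: k_def)
  qed
  then show thesis by (rule that)
qed

text \<open>Multilinearity in the rows: in the Leibniz formula the product of row sums becomes a sum
  over choice functions, and exchanging the sums yields one determinant per choice.\<close>

lemma det_eq_sum_over_row_choices:
  fixes x :: "nat \<Rightarrow> 'c \<Rightarrow> 'a :: comm_ring_1"
  assumes "\<And>a. a < n \<Longrightarrow> finite (C a)"
  shows "det (mat n n (\<lambda>(a, b). \<Sum>c\<in>C a. x a c * y a c b)) =
    (\<Sum>f\<in>PiE {0..<n} C. (\<Prod>a = 0..<n. x a (f a)) * det (mat n n (\<lambda>(a, b). y a (f a) b)))"
proof -
  let ?P = "{p. p permutes {0..<n}}"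
  have lt: "p a < n" if "p permutes {0..<n}" "a < n" for p a
    using permutes_in_image[OF that(1), of a] that(2) by simp
  have "det (mat n n (\<lambda>(a, b). \<Sum>c\<in>C a. x a c * y a c b)) =
    (\<Sum>p\<in>?P. signof p * (\<Prod>a = 0..<n. \<Sum>c\<in>C a. x a c * y a c (p a)))"
    by (auto simp: det_def lt intro!: sum.cong prod.cong)
  also have "\<dots> = (\<Sum>p\<in>?P. \<Sum>f\<in>PiE {0..<n} C.
      signof p * ((\<Prod>a = 0..<n. x a (f a)) * (\<Prod>a = 0..<n. y a (f a) (p a))))"
    by (subst prod_sum_PiE) (use assms in \<open>auto simp: sum_distrib_left prod.distrib\<close>)
  also have "\<dots> = (\<Sum>f\<in>PiE {0..<n} C. \<Sum>p\<in>?P.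
      signof p * ((\<Prod>a = 0..<n. x a (f a)) * (\<Prod>a = 0..<n. y a (f a) (p a))))"
    by (rule sum.swap)
  also have "\<dots> = (\<Sum>f\<in>PiE {0..<n} C. (\<Prod>a = 0..<n. x a (f a)) *
      (\<Sum>p\<in>?P. signof p * (\<Prod>a = 0..<n. y a (f a) (p a))))"
    by (simp add: sum_distrib_left mult_ac)
  also have "\<dots> = (\<Sum>f\<in>PiE {0..<n} C. (\<Prod>a = 0..<n. x a (f a)) *
      det (mat n n (\<lambda>(a, b). y a (f a) b)))"
    by (auto simp: det_def lt intro!: sum.cong prod.cong arg_cong2[where f = "(*)"])
  finally show ?thesis .
qed

text \<open>The minors along row \<open>i\<close> do not see that row, so overwriting it keeps its
  cofactors, and Laplace expansion along a unit row leaves a single one.\<close>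

lemma cofactor_eq_det_replace_row:
  fixes A :: "'a :: comm_ring_1 mat"
  assumes A: "A \<in> carrier_mat n n" and ij: "i < n" "j < n"
  shows "cofactor A i j = det (mat n n (\<lambda>(a, b). if a = i then of_bool (b = j) else A $$ (a, b)))"
proof -
  let ?B = "mat n n (\<lambda>(a, b). if a = i then of_bool (b = j) else A $$ (a, b))"
  have "mat_delete ?B i j = mat_delete A i j"
    using assms by (auto simp: mat_delete_def intro!: eq_matI)
  then have "cofactor ?B i j = cofactor A i j" by (simp add: cofactor_def)
  moreover have "det ?B = (\<Sum>b<n. ?B $$ (i, b) * cofactor ?B i b)"
    using ij(1) by (intro laplace_expansion_row) auto
  moreover have "\<dots> = (\<Sum>b<n. if b = j then cofactor ?B i b else 0)"
    using ij(1) by (intro sum.cong) auto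
  ultimately show ?thesis using ij(2) by simp
qed

text \<open>Sorted by \<open>f\<close> the matrix is unitriangular. A permutation preserves the sum
  of \<open>f\<close>, so unless it is the identity it moves some point without lowering
  \<open>f\<close>, and its Leibniz term vanishes.\<close>

lemma det_eq_1_if_rank_decreasing:
  fixes f :: "nat \<Rightarrow> nat" and A :: "'a :: comm_ring_1 mat"
  assumes A: "A \<in> carrier_mat n n"
    and diag: "\<And>a. a < n \<Longrightarrow> A $$ (a, a) = 1"
    and off: "\<And>a b. a < n \<Longrightarrow> b < n \<Longrightarrow> a \<noteq> b \<Longrightarrow> f a \<le> f b \<Longrightarrow> A $$ (a, b) = 0"
  shows "det A = 1"
proof -
  let ?P = "{p. p permutes {0..<n}}"
  have "(\<Prod>a = 0..<n. A $$ (a, p a)) = 0" if p: "p permutes {0..<n}" "p \<noteq> id" for p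
  proof -
    have lt: "p a < n" if "a < n" for a
      using permutes_in_image[OF p(1), of a] that by simp
    have "\<exists>a<n. p a \<noteq> a \<and> f a \<le> f (p a)"
    proof (rule ccontr)
      assume "\<not> ?thesis"
      then have less: "f (p a) < f a" if "a < n" "p a \<noteq> a" for a
        using that by (meson not_le)
      from p obtain a where "p a \<noteq> a" by (auto simp: fun_eq_iff)
      moreover from this p(1) have "a < n" by (auto dest: permutes_not_in)
      moreover have "f (p b) \<le> f b" if "b < n" for b
        using less[OF that] by (cases "p b = b") auto
      ultimately have "(\<Sum>a = 0..<n. f (p a)) < (\<Sum>a = 0..<n. f a)"
        using less by (intro sum_strict_mono_ex1 ballI bexI[of _ a]) auto
      moreover have "(\<Sum>a = 0..<n. f (p a)) = (\<Sum>a = 0..<n. f a)"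
        using p(1) by (metis sum.permute comp_apply sum.cong)
      ultimately show False by simp
    qed
    then obtain a where "a < n" "A $$ (a, p a) = 0" using off lt by metis
    then show ?thesis by (intro prod_zero) auto
  qed
  then have "det A = (\<Sum>p\<in>?P. if p = id then 1 else 0)"
    unfolding det_def'[OF A] by (intro sum.cong) (auto simp: diag)
  also have "\<dots> = 1" by (simp add: finite_permutations permutes_id)
  finally show ?thesis .
qed

text \<open>The matrix attached to one choice: \<open>p a\<close> is the tail of the arc chosen into
  \<open>a\<close>. A chosen loop gives a zero row.\<close>

definition link_mat :: "nat \<Rightarrow> nat \<Rightarrow> nat \<Rightarrow> (nat \<Rightarrow> nat option) \<Rightarrow> real mat" where
  "link_mat n i j p = mat n n (\<lambda>(a, b).
     if a = i then of_bool (b = j) else of_bool (a = b) - of_bool (p a = Some b))"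

lemma link_mat_carrier [simp]: "link_mat n i j p \<in> carrier_mat n n"
  by (simp add: link_mat_def)

text \<open>The vector \<open>x\<close> lies in the kernel: row \<open>i\<close> yields
  \<open>x j\<close>, a row without link \<open>x a\<close>, and a linked row
  \<open>x a - x b\<close>.\<close>

lemma det_link_mat_eq_0:
  fixes x :: "nat \<Rightarrow> real"
  assumes "i < n" "j < n" and p: "\<And>a b. p a = Some b \<Longrightarrow> b < n"
    and x: "\<exists>a<n. x a \<noteq> 0" "x j = 0"
    and root: "\<And>a. a < n \<Longrightarrow> a \<noteq> i \<Longrightarrow> p a = None \<Longrightarrow> x a = 0"
    and link: "\<And>a b. a < n \<Longrightarrow> a \<noteq> i \<Longrightarrow> p a = Some b \<Longrightarrow> x a = x b"
  shows "det (link_mat n i j p) = 0"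
proof -
  have row: "(\<Sum>b<n. link_mat n i j p $$ (a, b) * x b) = 0" if a: "a < n" for a
  proof (cases "a = i")
    case True
    have "(\<Sum>b<n. link_mat n i j p $$ (a, b) * x b) = (\<Sum>b<n. if b = j then x b else 0)"
      using True a by (intro sum.cong) (auto simp: link_mat_def)
    then show ?thesis using assms by simp
  next
    case False
    have "(\<Sum>b<n. link_mat n i j p $$ (a, b) * x b) =
        (\<Sum>b<n. (if b = a then x b else 0) - (if p a = Some b then x b else 0))"
      using False a by (intro sum.cong) (auto simp: link_mat_def)
    also have "\<dots> = x a - (\<Sum>b<n. if p a = Some b then x b else 0)"
      using a by (simp add: sum_subtractf)
    also have "\<dots> = 0"
      using False a root link p by (cases "p a") auto
    finally show ?thesis .
  qed
  let ?v = "vec n x"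
  have "link_mat n i j p *\<^sub>v ?v = 0\<^sub>v n"
    using row by (intro eq_vecI)
      (auto simp: scalar_prod_def carrier_matD[OF link_mat_carrier] atLeast0LessThan)
  moreover have "?v \<noteq> 0\<^sub>v n"
    using x(1) by (metis index_vec index_zero_vec(1))
  ultimately show ?thesis
    using det_0_iff_vec_prod_zero[OF link_mat_carrier] vec_carrier by blast
qed

lemma cofactor_orthogonal:
  fixes A :: "'a :: comm_ring_1 mat"
  assumes A: "A \<in> carrier_mat n n" and "a < n" "i < n"
  shows "(\<Sum>b<n. A $$ (a, b) * cofactor A i b) = (if a = i then det A else 0)"
proof -
  have "(A * adj_mat A) $$ (a, i) = (\<Sum>b<n. A $$ (a, b) * cofactor A i b)"
    using assms by (auto simp: adj_mat_def scalar_prod_def atLeast0LessThan)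
  moreover have "(A * adj_mat A) $$ (a, i) = (det A \<cdot>\<^sub>m 1\<^sub>m n) $$ (a, i)"
    by (simp only: adj_mat(2)[OF A])
  ultimately show ?thesis using assms by (auto split: if_splits)
qed

text \<open>If either condition fails, the indicator of a set that links neither enter nor leave is
  a kernel vector. If both hold, the case \<open>j = i\<close> is unitriangular up to order, and
  general \<open>j\<close> is reached through the cofactors of that matrix.\<close>

lemma det_link_mat:
  fixes p :: "nat \<Rightarrow> nat option"
  defines "E \<equiv> {(a, b). p a = Some b}"
  assumes ij: "i < n" "j < n" and p: "\<And>a b. p a = Some b \<Longrightarrow> a < n \<and> b < n" and i: "p i = None"
  shows "det (link_mat n i j p) =
    of_bool ((j, i) \<in> E\<^sup>* \<and> (\<forall>a. \<exists>r. p r = None \<and> (a, r) \<in> E\<^sup>*))"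
proof -
  \<comment> \<open>A walk from \<open>a\<close> to a terminal \<open>r\<close> is not empty, and
    its first step can only go to \<open>b\<close>.\<close>
  have step: "(a, r) \<in> E\<^sup>* \<longleftrightarrow> (b, r) \<in> E\<^sup>*" if "p a = Some b" "p r = None" for a b r
    using that by (auto simp: E_def intro: converse_rtrancl_into_rtrancl elim: converse_rtranclE)
  consider (no_path) "(j, i) \<notin> E\<^sup>*"
    | (endless) a where "(j, i) \<in> E\<^sup>*" "\<forall>r. p r = None \<longrightarrow> (a, r) \<notin> E\<^sup>*"
    | (good) "(j, i) \<in> E\<^sup>*" "\<And>a. \<exists>r. p r = None \<and> (a, r) \<in> E\<^sup>*" by blast
  then show ?thesis
  proof cases
    case no_path
    have "det (link_mat n i j p) = 0"
    proof (rule det_link_mat_eq_0[where x = "\<lambda>a. of_bool ((a, i) \<in> E\<^sup>*)"])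
      show "\<exists>a<n. of_bool ((a, i) \<in> E\<^sup>*) \<noteq> (0 :: real)" using ij by auto
      show "of_bool ((a, i) \<in> E\<^sup>*) = (0 :: real)" if "a \<noteq> i" "p a = None" for a
        using that by (auto simp: E_def elim: converse_rtranclE)
    qed (use ij p no_path step i in auto)
    then show ?thesis using no_path by simp
  next
    case endless
    let ?x = "\<lambda>a. of_bool (\<forall>r. p r = None \<longrightarrow> (a, r) \<notin> E\<^sup>*) :: real"
    \<comment> \<open>An index outside the range has no link, so it would be terminal
      itself.\<close>
    have "a < n" using endless p by (metis not_None_eq rtrancl.rtrancl_refl)
    have "det (link_mat n i j p) = 0"
    proof (rule det_link_mat_eq_0[where x = ?x])
      show "\<exists>a<n. ?x a \<noteq> 0" using endless \<open>a < n\<close> by auto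
      show "?x j = 0" using endless i by auto
      show "?x a = ?x b" if "p a = Some b" for a b using step[OF that] by auto
    qed (use ij p in auto)
    moreover have "\<not> (\<forall>a. \<exists>r. p r = None \<and> (a, r) \<in> E\<^sup>*)" using endless by blast
    ultimately show ?thesis by simp
  next
    case good
    then obtain f :: "nat \<Rightarrow> nat" where f: "\<And>a b. p a = Some b \<Longrightarrow> f b < f a"
      using ex_rank_if_all_terminate[of p] unfolding E_def by blast
    \<comment> \<open>Here row \<open>i\<close> is the unit row at \<open>i\<close>, so off the
      diagonal only links give nonzero entries, and \<open>f\<close> drops along links.\<close>
    let ?A = "link_mat n i i p"
    have "det ?A = 1"
      by (rule det_eq_1_if_rank_decreasing[where f = f, OF link_mat_carrier])
        (auto simp: link_mat_def dest: f)
    \<comment> \<open>Row \<open>a\<close> of \<open>A * adj A\<close> shows that these cofactors are constant along links.\<close>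
    have "cofactor ?A i a = 1" if "(a, i) \<in> E\<^sup>*" for a
      using that
    proof (induction rule: converse_rtrancl_induct)
      case base
      have "(\<Sum>b<n. ?A $$ (i, b) * cofactor ?A i b) = (\<Sum>b<n. if b = i then cofactor ?A i b else 0)"
        using ij by (intro sum.cong) (auto simp: link_mat_def)
      then show ?case
        using cofactor_orthogonal[OF link_mat_carrier ij(1) ij(1), of i i p] ij \<open>det ?A = 1\<close> by simp
    next
      case (step a c)
      then have a: "p a = Some c" by (simp add: E_def)
      with p i have "a < n" "c < n" "a \<noteq> i" by auto
      have "0 = (\<Sum>b<n. ?A $$ (a, b) * cofactor ?A i b)"
        using cofactor_orthogonal[OF link_mat_carrier \<open>a < n\<close> ij(1), of i i p] \<open>a \<noteq> i\<close> by simp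
      also have "\<dots> = (\<Sum>b<n. (if b = a then cofactor ?A i b else 0) -
          (if b = c then cofactor ?A i b else 0))"
        using \<open>a < n\<close> \<open>a \<noteq> i\<close> a by (intro sum.cong) (auto simp: link_mat_def)
      also have "\<dots> = cofactor ?A i a - cofactor ?A i c"
        using \<open>a < n\<close> \<open>c < n\<close> by (simp add: sum_subtractf)
      finally show ?case using step.IH by simp
    qed
    then have "cofactor ?A i j = 1" using good by blast
    \<comment> \<open>Only row \<open>i\<close> differs between the two matrices, so the determinant
      is the cofactor just computed.\<close>
    moreover have "link_mat n i j p =
        mat n n (\<lambda>(a, b). if a = i then of_bool (b = j) else ?A $$ (a, b))"
      by (auto simp: link_mat_def intro!: eq_matI)
    ultimately have "det (link_mat n i j p) = 1"
      using cofactor_eq_det_replace_row[OF link_mat_carrier ij, of i i p] by simp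
    then show ?thesis using good by simp
  qed
qed

section \<open>Components and diverging forests\<close>

lemma underlying_sel [simp]:
  "verts (underlying G) = verts G"
  "arcs (underlying G) = arcs G \<times> UNIV"
  "tail (underlying G) (e, b) = (if b then head G e else tail G e)"
  "head (underlying G) (e, b) = (if b then tail G e else head G e)"
  by (simp_all add: underlying_def)

lemma (in wf_digraph) wf_digraph_underlying: "wf_digraph (underlying G)"
  by unfold_locales auto

text \<open>Connectedness is defined through \<open>mk_symmetric\<close>, undirected cycles through
  \<open>underlying\<close>. Reachability depends only on pairs of ends, so
  \<open>underlying\<close> serves for both.\<close>

lemma arcs_ends_underlying: "arcs_ends (underlying G) = arcs_ends (mk_symmetric G)"
  by (force simp: arcs_ends_conv parcs_mk_symmetric underlying_def image_iff)

lemma symmetric_underlying: "symmetric (underlying G)"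
  unfolding symmetric_def arcs_ends_underlying
  using symmetric_mk_symmetric symmetric_def by blast

lemma connected_iff_underlying:
  "Digraph_Component.connected G \<longleftrightarrow>
    verts G \<noteq> {} \<and> (\<forall>u \<in> verts G. \<forall>v \<in> verts G. u \<rightarrow>\<^sup>*\<^bsub>underlying G\<^esub> v)"
  by (simp add: Digraph_Component.connected_def strongly_connected_def reachable_def
      arcs_ends_underlying)

lemma subgraph_underlying:
  assumes "subgraph H G"
  shows "subgraph (underlying H) (underlying G)"
  using assms wf_digraph.wf_digraph_underlying[of G] wf_digraph.wf_digraph_underlying[of H]
  by (auto simp: subgraph_def compatible_def underlying_def)

lemma underlying_induce_subgraph: "underlying (G \<restriction> S) = underlying G \<restriction> S"
  by (auto simp: underlying_def induce_subgraph_def split: if_splits)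

text \<open>Induced, because adding an arc between two vertices of a connected subgraph keeps it
  connected, so a maximal one contains all such arcs.\<close>

definition component_of :: "('a, 'b) pre_digraph \<Rightarrow> 'a \<Rightarrow> ('a, 'b) pre_digraph" where
  "component_of G v = G \<restriction> {u. v \<rightarrow>\<^sup>*\<^bsub>underlying G\<^esub> u}"

lemma verts_component_of: "verts (component_of G v) = {u. v \<rightarrow>\<^sup>*\<^bsub>underlying G\<^esub> u}"
  by (simp add: component_of_def)

context wf_digraph
begin

interpretation U: wf_digraph "underlying G"
  by (rule wf_digraph_underlying)

lemma subgraph_component_of: "subgraph (component_of G v) G"
  unfolding component_of_def
  by (rule subgraph_induce_subgraphI) (auto dest: U.reachable_in_verts)

lemma connected_component_of:
  assumes "v \<in> verts G"
  shows "Digraph_Component.connected (component_of G v)"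
proof -
  let ?C = "component_of G v"
  interpret C: wf_digraph "underlying ?C"
    using subgraph_component_of by (intro wf_digraph.wf_digraph_underlying) auto
  have "v \<rightarrow>\<^sup>*\<^bsub>underlying ?C\<^esub> u" if "u \<in> verts ?C" for u
    using that U.induce_reachable_preserves_paths[of v u]
    by (simp add: component_of_def underlying_induce_subgraph)
  then show ?thesis
    unfolding connected_iff_underlying
    using assms symmetric_reachable[OF symmetric_underlying] C.reachable_trans
    by (metis U.reachable_refl underlying_sel(1) verts_component_of mem_Collect_eq empty_iff)
qed

lemma connected_subgraph_component_of:
  assumes "subgraph C G" "Digraph_Component.connected C" "v \<in> verts C"
  shows "subgraph C (component_of G v)"
proof -
  have "v \<rightarrow>\<^sup>*\<^bsub>underlying G\<^esub> u" if "u \<in> verts C" for u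
    using assms that subgraph_underlying U.reachable_mono
    unfolding connected_iff_underlying by blast
  then have "verts C \<subseteq> verts (component_of G v)"
    by (auto simp: verts_component_of)
  with assms(1) show ?thesis
    by (auto simp: component_of_def subgraph_def compatible_def wf_digraph_def)
qed

text \<open>Every connected subgraph through \<open>v\<close> lies inside
  \<open>component_of G v\<close>, which is connected itself. So the latter is maximal, and a
  maximal one through \<open>v\<close> equals it.\<close>

lemma components_eq: "components G = component_of G ` verts G"
proof -
  have "component_of G v \<in> components G" if "v \<in> verts G" for v
  proof -
    have "H = component_of G v"
      if "subgraph (component_of G v) H" "subgraph H G" "Digraph_Component.connected H" for H
    proof -
      have "v \<in> verts H" using that(1) \<open>v \<in> verts G\<close> by (auto simp: subgraph_def verts_component_of)
      with that connected_subgraph_component_of have "subgraph H (component_of G v)" by blast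
      with that(1) show ?thesis by (auto simp: subgraph_def compatible_def)
    qed
    then show ?thesis
      using subgraph_component_of connected_component_of[OF that]
      by (auto simp: components_def max_subgraph_def)
  qed
  moreover have "C \<in> component_of G ` verts G" if "C \<in> components G" for C
  proof -
    from that have C: "subgraph C G" "Digraph_Component.connected C"
      "\<And>H. H \<noteq> C \<Longrightarrow> subgraph C H \<Longrightarrow> subgraph H G \<Longrightarrow> \<not> Digraph_Component.connected H"
      by (auto simp: components_def max_subgraph_def)
    then obtain v where "v \<in> verts C" by (auto simp: connected_iff_underlying)
    moreover from this C(1) have "v \<in> verts G" by (auto simp: subgraph_def)
    ultimately have "component_of G v = C"
      using C(3)[of "component_of G v"] connected_subgraph_component_of[OF C(1,2)]
        subgraph_component_of connected_component_of by blast
    with \<open>v \<in> verts G\<close> show ?thesis by blast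
  qed
  ultimately show ?thesis by blast
qed

lemma component_of_eq:
  assumes "u \<rightarrow>\<^sup>*\<^bsub>underlying G\<^esub> v"
  shows "component_of G u = component_of G v"
proof -
  have "v \<rightarrow>\<^sup>*\<^bsub>underlying G\<^esub> u" using symmetric_reachable[OF symmetric_underlying assms] .
  then have "{x. u \<rightarrow>\<^sup>*\<^bsub>underlying G\<^esub> x} = {x. v \<rightarrow>\<^sup>*\<^bsub>underlying G\<^esub> x}"
    by (auto intro: U.reachable_trans[OF assms] U.reachable_trans)
  then show ?thesis by (simp add: component_of_def)
qed

lemma reachable_underlyingI:
  assumes "u \<rightarrow>\<^sup>* v"
  shows "u \<rightarrow>\<^sup>*\<^bsub>underlying G\<^esub> v"
  using reachable_mk_symmetricI[OF assms] by (simp add: reachable_def arcs_ends_underlying)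

end

section \<open>Branchings, a local description of forests, are diverging forests\<close>

locale branching = wf_digraph H for H :: "('a, 'b) pre_digraph" (structure) +
  fixes R :: "'a set"
  assumes root_in_verts: "r \<in> R \<Longrightarrow> r \<in> verts H"
    and head_not_root: "e \<in> arcs H \<Longrightarrow> head H e \<notin> R"
    and arc_unique: "e \<in> arcs H \<Longrightarrow> e' \<in> arcs H \<Longrightarrow> head H e = head H e' \<Longrightarrow> e = e'"
    and ex_root: "v \<in> verts H \<Longrightarrow> \<exists>r \<in> R. r \<rightarrow>\<^sup>* v"
begin

interpretation U: wf_digraph "underlying H"
  by (rule wf_digraph_underlying)

lemma ex_in_arc:
  assumes "v \<in> verts H" "v \<notin> R"
  shows "\<exists>e \<in> arcs H. head H e = v"
proof -
  obtain r where r: "r \<in> R" "r \<rightarrow>\<^sup>* v" using assms(1) ex_root by blast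
  with assms(2) have "(r, v) \<in> (arcs_ends H)\<^sup>+" by auto
  then obtain z where "(z, v) \<in> arcs_ends H" by (meson tranclD2)
  then show ?thesis by auto
qed

text \<open>Following incoming arcs backwards from a vertex retraces a walk from a root and stops
  there, so the number of steps is a rank.\<close>

lemma ex_rank:
  obtains f :: "'a \<Rightarrow> nat" where "\<And>e. e \<in> arcs H \<Longrightarrow> f (tail H e) < f (head H e)"
proof -
  define p where "p v = (if \<exists>e\<in>arcs H. head H e = v
    then Some (tail H (SOME e. e \<in> arcs H \<and> head H e = v)) else None)" for v
  have p: "p (head H e) = Some (tail H e)" if "e \<in> arcs H" for e
  proof -
    have "(SOME e'. e' \<in> arcs H \<and> head H e' = head H e) = e"
      using that arc_unique by (intro some_equality) auto
    then show ?thesis using that by (auto simp: p_def)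
  qed
  have "(v, r) \<in> {(a, b). p a = Some b}\<^sup>*" if "r \<rightarrow>\<^sup>* v" for r v
    using that
  proof (induction rule: reachable_induct)
    case (step x y)
    then have "(y, x) \<in> {(a, b). p a = Some b}" using p by auto
    then show ?case using step.IH by (rule converse_rtrancl_into_rtrancl)
  qed simp
  moreover have "p r = None" if "r \<in> R" for r
    using that head_not_root by (auto simp: p_def)
  ultimately have "\<exists>r. p r = None \<and> (v, r) \<in> {(a, b). p a = Some b}\<^sup>*" for v
  proof (cases "v \<in> verts H")
    case True
    then obtain r where "r \<in> R" "r \<rightarrow>\<^sup>* v" using ex_root by blast
    then show ?thesis
      using \<open>\<And>r. r \<in> R \<Longrightarrow> p r = None\<close> \<open>\<And>r v. r \<rightarrow>\<^sup>* v \<Longrightarrow> (v, r) \<in> {(a, b). p a = Some b}\<^sup>*\<close> by blast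
  next
    case False
    then have "p v = None" by (auto simp: p_def)
    then show ?thesis by blast
  qed
  then obtain f :: "'a \<Rightarrow> nat" where "\<And>a b. p a = Some b \<Longrightarrow> f b < f a"
    using ex_rank_if_all_terminate by blast
  with p that show thesis by blast
qed

text \<open>A cycle cannot start forwards or end backwards, since \<open>f\<close> would then change
  strictly around it. So its first and last arcs both have the base vertex as head and coincide, yet
  they are traversed in opposite directions, so an arc is repeated.\<close>

lemma no_undirected_cycle: "\<not> undirected_cycle H c"
proof
  assume "undirected_cycle H c"
  then obtain u where c: "U.awalk u c u" "distinct (map fst c)" "c \<noteq> []"
    by (auto simp: undirected_cycle_def U.cycle_def)
  obtain f :: "'a \<Rightarrow> nat" where f: "\<And>e. e \<in> arcs H \<Longrightarrow> f (tail H e) < f (head H e)"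
    using ex_rank by blast
  \<comment> \<open>Without repeated edges, a walk that has once followed an arc forwards never turns back,
    since each vertex has only one incoming arc.\<close>
  have down: "f u < f v \<and> (\<forall>x \<in> set p. \<not> snd x)"
    if "U.awalk u ((e, False) # p) v" "distinct (map fst ((e, False) # p))" for u e p v
    using that
  proof (induction p arbitrary: u e)
    case Nil
    then show ?case using f by (auto simp: U.awalk_simps)
  next
    case (Cons x p)
    obtain e' b where x: "x = (e', b)" by force
    with Cons.prems have *: "e \<in> arcs H" "e' \<in> arcs H" "u = tail H e" "e \<noteq> e'"
      "U.awalk (head H e) ((e', b) # p) v"
      by (auto simp: U.awalk_simps)
    with arc_unique have "\<not> b" by (auto simp: U.awalk_Cons_iff)
    with * x Cons.IH[of "head H e" e'] Cons.prems f[of e] show ?case by auto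
  qed
  \<comment> \<open>Mirror image: by \<open>down\<close>, a forward arc before the last one would
    force the last one to be forward too.\<close>
  have up: "f v < f u"
    if "U.awalk u (p @ [(e, True)]) v" "distinct (map fst (p @ [(e, True)]))" for u e p v
    using that
  proof (induction p arbitrary: u)
    case Nil
    then show ?case using f by (auto simp: U.awalk_simps)
  next
    case (Cons x p)
    obtain e' b where x: "x = (e', b)" by force
    have b
    proof (rule ccontr)
      assume "\<not> b"
      with Cons.prems x down[of u e' "p @ [(e, True)]" v] show False by auto
    qed
    with Cons x have "f v < f (tail H e')" "e' \<in> arcs H" "u = head H e'"
      by (auto simp: U.awalk_Cons_iff)
    with f[of e'] show ?case by simp
  qed
  obtain e b p where hd: "c = (e, b) # p" using c(3) by (metis list.exhaust surj_pair)
  obtain e' b' q where last: "c = q @ [(e', b')]" using c(3) by (metis rev_exhaust surj_pair)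
  have b using down[of u e p u] c hd by auto
  have "\<not> b'" using up[of u q e' u] c last by auto
  have "e \<in> arcs H" "head H e = u" using c(1) hd \<open>b\<close> by (auto simp: U.awalk_Cons_iff)
  moreover have "e' \<in> arcs H" "head H e' = u"
    using c(1) last \<open>\<not> b'\<close> by (auto simp: U.awalk_Cons_iff U.awalk_Nil_iff)
  ultimately have "e = e'" using arc_unique by simp
  moreover have "(e', b') \<in> set p" using hd last \<open>b\<close> \<open>\<not> b'\<close> by (cases q) auto
  then have "e' \<in> fst ` set p" by force
  ultimately show False using c(2) hd by auto
qed

lemma directed_forest: "directed_forest H"
  using no_undirected_cycle wf_digraph by (simp add: directed_forest_def)

text \<open>The critical step goes from \<open>x\<close> against an arc to its tail
  \<open>y\<close>. No arc enters \<open>r\<close>, so \<open>x\<close> is not \<open>r\<close>, and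
  the directed walk from \<open>r\<close> to \<open>x\<close> ends with the only arc into
  \<open>x\<close>; hence it passes through \<open>y\<close>.\<close>

lemma reachable_underlying_root_iff:
  assumes "r \<in> R"
  shows "r \<rightarrow>\<^sup>*\<^bsub>underlying H\<^esub> v \<longleftrightarrow> r \<rightarrow>\<^sup>* v"
proof
  assume "r \<rightarrow>\<^sup>*\<^bsub>underlying H\<^esub> v"
  then show "r \<rightarrow>\<^sup>* v"
  proof (induction rule: U.reachable_induct)
    case base
    then show ?case using assms root_in_verts by simp
  next
    case (step x y)
    from step(2) consider e where "e \<in> arcs H" "tail H e = x" "head H e = y"
      | e where "e \<in> arcs H" "tail H e = y" "head H e = x"
      by (auto simp: arcs_ends_conv split: if_splits)
    then show ?case
    proof cases
      case 1
      then show ?thesis using step.IH in_arcs_imp_in_arcs_ends reachable_adj_trans by metis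
    next
      case 2
      then have "x \<noteq> r" using assms head_not_root by blast
      with step.IH have "(r, x) \<in> (arcs_ends H)\<^sup>+" by auto
      then obtain z where z: "(r, z) \<in> (arcs_ends H)\<^sup>*" "(z, x) \<in> arcs_ends H"
        by (meson tranclD2)
      then obtain e' where "e' \<in> arcs H" "tail H e' = z" "head H e' = x" by auto
      with 2 arc_unique have "z = y" by blast
      with z assms root_in_verts reachable_conv' show ?thesis by simp
    qed
  qed
qed (rule reachable_underlyingI)

lemma root_reachable_root:
  assumes "r \<rightarrow>\<^sup>* r'" "r' \<in> R"
  shows "r = r'"
proof (rule ccontr)
  assume "r \<noteq> r'"
  with assms have "(r, r') \<in> (arcs_ends H)\<^sup>+" by auto
  then obtain z where "(z, r') \<in> arcs_ends H" by (meson tranclD2)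
  then show False using head_not_root assms by auto
qed

lemma roots_component_of:
  assumes "r \<in> R"
  shows "R \<inter> verts (component_of H r) = {r}"
  using assms root_reachable_root root_in_verts
  by (auto simp: verts_component_of reachable_underlying_root_iff)

lemma diverging_tree_component_of:
  assumes "r \<in> R"
  shows "diverging_tree (component_of H r) r"
proof -
  let ?C = "component_of H r"
  have r: "r \<in> verts H" using assms by (rule root_in_verts)
  interpret C: wf_digraph ?C using subgraph_component_of by auto
  have "\<not> undirected_cycle ?C c" for c
    using no_undirected_cycle U.subgraph_cycle[OF subgraph_underlying[OF subgraph_component_of]]
    unfolding undirected_cycle_def by blast
  then have "directed_tree ?C"
    using C.wf_digraph connected_component_of[OF r]
    by (simp add: directed_tree_def directed_forest_def)
  moreover have "r \<rightarrow>\<^sup>*\<^bsub>?C\<^esub> v" if "v \<in> verts ?C" for v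
    using that induce_reachable_preserves_paths[of r v] assms
    by (simp add: component_of_def reachable_underlying_root_iff)
  ultimately show ?thesis
    using r by (auto simp: diverging_tree_def C.reachable_apath verts_component_of)
qed

lemma diverging_forest: "diverging_forest H R"
proof -
  have "\<exists>r. R \<inter> verts C = {r} \<and> diverging_tree C r" if "C \<in> components H" for C
  proof -
    from that obtain v where v: "v \<in> verts H" "C = component_of H v" by (auto simp: components_eq)
    then obtain r where r: "r \<in> R" "r \<rightarrow>\<^sup>* v" using ex_root by blast
    then have "C = component_of H r" using v component_of_eq reachable_underlyingI by metis
    with r roots_component_of diverging_tree_component_of show ?thesis by blast
  qed
  then show ?thesis using directed_forest root_in_verts by (auto simp: diverging_forest_def)
qed

end

section \<open>Diverging forests are branchings\<close>

context wf_digraph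
begin

interpretation U: wf_digraph "underlying G"
  by (rule wf_digraph_underlying)

text \<open>A second use of the first edge, in either direction, would put both its ends on the rest
  of the path, but \<open>u\<close> is one of them and does not recur.\<close>

lemma distinct_arcs_if_apath_underlying:
  assumes "U.apath u p v"
  shows "distinct (map fst p)"
  using assms
proof (induction p arbitrary: u)
  case (Cons x p)
  obtain e b where x: "x = (e, b)" by force
  let ?w = "head (underlying G) x"
  have p: "U.apath ?w p v" "u \<notin> set (U.awalk_verts ?w p)" and u: "tail (underlying G) x = u"
    using Cons.prems by (auto simp: U.apath_Cons_iff)
  have "(e, b') \<notin> set p" for b'
  proof
    assume "(e, b') \<in> set p"
    then have "tail (underlying G) (e, b') \<in> set (U.awalk_verts ?w p)"
      "head (underlying G) (e, b') \<in> set (U.awalk_verts ?w p)"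
      using p(1) U.awalk_verts_arc1 U.awalk_verts_arc2 by (blast intro: U.awalkI_apath)+
    with u x p(2) show False by (auto split: if_splits)
  qed
  with Cons.IH[OF p(1)] x show ?case by auto
qed simp

text \<open>Follow \<open>e\<close> and return along a simple path that avoids it; such a path
  repeats no edge. For a loop the return path is empty.\<close>

lemma undirected_cycle_if_arc_bypassed:
  assumes e: "e \<in> arcs G"
    and bypass: "head G e \<rightarrow>\<^sup>*\<^bsub>underlying (del_arc e)\<^esub> tail G e"
  shows "\<exists>c. undirected_cycle G c"
proof -
  let ?D = "del_arc e"
  interpret D: wf_digraph ?D by (rule wf_digraph_del_arc)
  interpret UD: wf_digraph "underlying ?D" by (rule D.wf_digraph_underlying)
  from bypass obtain p where p: "UD.apath (head G e) p (tail G e)"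
    by (auto simp: UD.reachable_apath)
  then have "set p \<subseteq> arcs (underlying ?D)" unfolding UD.apath_def by (blast elim: UD.awalkE')
  then have "e \<notin> fst ` set p" by auto
  have "subgraph (underlying ?D) (underlying G)"
    by (rule subgraph_underlying[OF subgraph_del_arc])
  then have p: "U.apath (head G e) p (tail G e)" using p U.subgraph_apath_imp_apath by blast
  let ?c = "(e, False) # p"
  have "U.awalk (tail G e) ?c (tail G e)" "distinct (U.awalk_verts (head G e) p)"
    using p e by (auto simp: U.apath_def U.awalk_Cons_iff)
  then have "U.cycle ?c" by (auto simp: U.cycle_def)
  moreover have "distinct (map fst ?c)"
    using distinct_arcs_if_apath_underlying[OF p] \<open>e \<notin> fst ` set p\<close> by simp
  ultimately show ?thesis by (auto simp: undirected_cycle_def)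
qed

text \<open>Cut the walk after its last use of \<open>e\<close>, if there is one.\<close>

lemma reachable_del_arc_or_head:
  assumes "u \<rightarrow>\<^sup>* v"
  shows "u \<rightarrow>\<^sup>*\<^bsub>del_arc e\<^esub> v \<or> head G e \<rightarrow>\<^sup>*\<^bsub>del_arc e\<^esub> v"
proof -
  interpret D: wf_digraph "del_arc e" by (rule wf_digraph_del_arc)
  show ?thesis
    using assms
  proof (induction rule: reachable_induct)
    case (step x y)
    then obtain e' where e': "e' \<in> arcs G" "tail G e' = x" "head G e' = y" by auto
    show ?case
    proof (cases "e' = e")
      case True
      then have "y = head G e" using e' by simp
      moreover have "y \<in> verts (del_arc e)" using e' by auto
      ultimately show ?thesis using D.reachable_refl by blast
    next
      case False
      then have "x \<rightarrow>\<^bsub>del_arc e\<^esub> y" using e' by (force simp: arcs_ends_conv)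
      then show ?thesis using step.IH D.reachable_adj_trans by blast
    qed
  qed simp
qed

end

locale undirected_forest = wf_digraph G for G :: "('a, 'b) pre_digraph" (structure) +
  assumes no_undirected_cycle: "\<not> undirected_cycle G c"
begin

lemma not_reachable_head_tail:
  assumes "e \<in> arcs G"
  shows "\<not> head G e \<rightarrow>\<^sup>* tail G e"
proof
  assume "head G e \<rightarrow>\<^sup>* tail G e"
  \<comment> \<open>For a walk that starts at \<open>head G e\<close> the two alternatives
    coincide.\<close>
  then have "head G e \<rightarrow>\<^sup>*\<^bsub>del_arc e\<^esub> tail G e" using reachable_del_arc_or_head by blast
  then have "head G e \<rightarrow>\<^sup>*\<^bsub>underlying (del_arc e)\<^esub> tail G e"
    by (rule wf_digraph.reachable_underlyingI[OF wf_digraph_del_arc])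
  with assms undirected_cycle_if_arc_bypassed no_undirected_cycle show False by blast
qed

text \<open>
  Neither of the two walks from \<open>r\<close> uses \<open>e\<close>, so without \<open>e\<close> its ends are still joined: by way of
  \<open>e'\<close>, the walk to \<open>e'\<close> reversed, and the walk to \<open>e\<close>.
\<close>

lemma in_arc_unique_if_common_source:
  assumes e: "e \<in> arcs G" "e' \<in> arcs G" "head G e = head G e'"
    and r: "r \<rightarrow>\<^sup>* tail G e" "r \<rightarrow>\<^sup>* tail G e'"
  shows "e = e'"
proof (rule ccontr)
  assume "e \<noteq> e'"
  let ?D = "del_arc e"
  interpret D: wf_digraph ?D by (rule wf_digraph_del_arc)
  interpret UD: wf_digraph "underlying ?D" by (rule D.wf_digraph_underlying)
  \<comment> \<open>Otherwise a directed walk would lead from the common head back to the tail of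
    \<open>e\<close> or \<open>e'\<close>. This excludes that the walks from \<open>r\<close> must
    use \<open>e\<close>.\<close>
  have no: "\<not> head G e \<rightarrow>\<^sup>*\<^bsub>?D\<^esub> tail G x" if "x \<in> {e, e'}" for x
  proof
    assume "head G e \<rightarrow>\<^sup>*\<^bsub>?D\<^esub> tail G x"
    then have "head G e \<rightarrow>\<^sup>* tail G x" by (rule reachable_mono[OF _ subgraph_del_arc])
    with that e not_reachable_head_tail[of x] show False by auto
  qed
  have "r \<rightarrow>\<^sup>*\<^bsub>?D\<^esub> tail G e" "r \<rightarrow>\<^sup>*\<^bsub>?D\<^esub> tail G e'"
    using reachable_del_arc_or_head[OF r(1)] reachable_del_arc_or_head[OF r(2)] no by blast+
  moreover have "tail G e' \<rightarrow>\<^bsub>?D\<^esub> head G e"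
    using e \<open>e \<noteq> e'\<close> by (force simp: arcs_ends_conv)
  ultimately have "r \<rightarrow>\<^sup>*\<^bsub>?D\<^esub> head G e" "r \<rightarrow>\<^sup>*\<^bsub>?D\<^esub> tail G e"
    using D.reachable_adj_trans by blast+
  then have "head G e \<rightarrow>\<^sup>*\<^bsub>underlying ?D\<^esub> r" "r \<rightarrow>\<^sup>*\<^bsub>underlying ?D\<^esub> tail G e"
    by (auto intro: D.reachable_underlyingI symmetric_reachable[OF symmetric_underlying])
  then have "head G e \<rightarrow>\<^sup>*\<^bsub>underlying ?D\<^esub> tail G e" by (rule UD.reachable_trans)
  with e undirected_cycle_if_arc_bypassed no_undirected_cycle show False by blast
qed

end

text \<open>The root of a component reaches all its vertices. So an arc into the root would close a
  directed cycle, and two arcs with the same head have tails that are reachable from a common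
  source.\<close>

lemma branching_if_diverging_forest:
  assumes "diverging_forest H R"
  shows "branching H R"
proof -
  have forest: "directed_forest H" and R: "R \<subseteq> verts H"
    and comp: "\<And>C. C \<in> components H \<Longrightarrow> \<exists>r. R \<inter> verts C = {r} \<and> diverging_tree C r"
    using assms by (auto simp: diverging_forest_def)
  interpret undirected_forest H
    using forest
    by (auto simp: directed_forest_def undirected_forest_def undirected_forest_axioms_def)
  interpret U: wf_digraph "underlying H" by (rule wf_digraph_underlying)
  have root: "\<exists>r. R \<inter> verts (component_of H v) = {r} \<and>
      (\<forall>u \<in> verts (component_of H v). r \<rightarrow>\<^sup>*\<^bsub>H\<^esub> u)" if v: "v \<in> verts H" for v
  proof -
    let ?C = "component_of H v"
    interpret C: wf_digraph ?C using subgraph_component_of by auto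
    obtain r where "R \<inter> verts ?C = {r}" "diverging_tree ?C r"
      using v comp[of ?C] by (auto simp: components_eq)
    moreover have "r \<rightarrow>\<^sup>*\<^bsub>H\<^esub> u" if "u \<in> verts ?C" "diverging_tree ?C r" for u
      using that reachable_mono[OF _ subgraph_component_of]
      by (auto simp: diverging_tree_def C.reachable_apath[symmetric])
    ultimately show ?thesis by blast
  qed
  show ?thesis
  proof unfold_locales
    fix v assume v: "v \<in> verts H"
    then have "v \<in> verts (component_of H v)" by (simp add: verts_component_of)
    with root[OF v] show "\<exists>r \<in> R. r \<rightarrow>\<^sup>*\<^bsub>H\<^esub> v" by blast
  next
    fix e assume e: "e \<in> arcs H"
    let ?C = "component_of H (head H e)"
    have "tail H e \<rightarrow>\<^sup>*\<^bsub>H\<^esub> head H e" using e in_arcs_imp_in_arcs_ends by blast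
    then have tail: "tail H e \<in> verts ?C"
      unfolding verts_component_of
      by (blast intro: reachable_underlyingI symmetric_reachable[OF symmetric_underlying])
    have "head H e \<in> verts ?C" using e by (simp add: verts_component_of)
    moreover obtain r where "R \<inter> verts ?C = {r}" "\<And>u. u \<in> verts ?C \<Longrightarrow> r \<rightarrow>\<^sup>*\<^bsub>H\<^esub> u"
      using root[of "head H e"] e by auto
    ultimately show "head H e \<notin> R"
      using tail not_reachable_head_tail[OF e] by (metis IntI singletonD)
  next
    fix e e' assume e: "e \<in> arcs H" "e' \<in> arcs H" "head H e = head H e'"
    let ?C = "component_of H (head H e)"
    have "tail H x \<in> verts ?C" if "x \<in> {e, e'}" for x
    proof -
      have "tail H x \<rightarrow>\<^sup>*\<^bsub>H\<^esub> head H e" using that e in_arcs_imp_in_arcs_ends by force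
      then show ?thesis
        unfolding verts_component_of
        by (blast intro: reachable_underlyingI symmetric_reachable[OF symmetric_underlying])
    qed
    then obtain r where "r \<rightarrow>\<^sup>*\<^bsub>H\<^esub> tail H e" "r \<rightarrow>\<^sup>*\<^bsub>H\<^esub> tail H e'"
      using root[of "head H e"] e(1) by auto
    with e show "e = e'" by (rule in_arc_unique_if_common_source)
  qed (use R in auto)
qed

lemma diverging_forest_iff_branching: "diverging_forest H R \<longleftrightarrow> branching H R"
  using branching_if_diverging_forest branching.diverging_forest by blast

lemma forests_from_to_eq:
  "forests_from_to G i j = {(H, R). spanning H G \<and> branching H R \<and> i \<in> R \<and> i \<rightarrow>\<^sup>*\<^bsub>H\<^esub> j}"
proof -
  have "(\<exists>C \<in> components H. i \<in> verts C \<and> j \<in> verts C \<and> R \<inter> verts C = {i}) \<longleftrightarrow>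
      i \<in> R \<and> i \<rightarrow>\<^sup>*\<^bsub>H\<^esub> j" if "branching H R" for H R
  proof -
    interpret branching H R by (rule that)
    have "i \<rightarrow>\<^sup>*\<^bsub>H\<^esub> j"
      if C: "C \<in> components H" "j \<in> verts C" "R \<inter> verts C = {i}" for C
    proof -
      obtain v where "C = component_of H v" using C(1) by (auto simp: components_eq)
      then have "i \<in> R" "v \<rightarrow>\<^sup>*\<^bsub>underlying H\<^esub> i" "v \<rightarrow>\<^sup>*\<^bsub>underlying H\<^esub> j"
        using C by (auto simp: verts_component_of)
      then show ?thesis
        using component_of_eq[of v i] reachable_underlying_root_iff[of i j]
        by (metis mem_Collect_eq verts_component_of)
    qed
    moreover have "component_of H i \<in> components H" "i \<in> verts (component_of H i)"
      "R \<inter> verts (component_of H i) = {i}" "i \<rightarrow>\<^sup>*\<^bsub>H\<^esub> j \<Longrightarrow> j \<in> verts (component_of H i)"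
      if "i \<in> R"
      using roots_component_of[OF that] root_in_verts[OF that]
      by (auto simp: components_eq verts_component_of reachable_underlying_root_iff[OF that])
    ultimately show ?thesis by blast
  qed
  then show ?thesis
    by (auto simp: forests_from_to_def spanning_diverging_forests_def diverging_forest_iff_branching)
qed

section \<open>Expansion of the cofactor\<close>

text \<open>One term per incoming arc is the shape that the row expansion requires. For a loop the
  two indicators agree, so it adds nothing on or off the diagonal.\<close>

lemma (in fin_digraph) kirchhoff_entry_eq:
  "kirchhoff_entry w G v u =
    (\<Sum>e \<in> in_arcs G v. w e * (of_bool (v = u) - of_bool (tail G e = u)))"
proof (cases "v = u")
  case True
  let ?S = "{e \<in> arcs G. head G e = v \<and> tail G e \<noteq> v}"
  have "(\<Sum>k \<in> verts G - {v}. total_weight w G k v) =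
      (\<Sum>k \<in> verts G - {v}. sum w {e \<in> ?S. tail G e = k})"
    unfolding total_weight_def by (intro sum.cong refl arg_cong2[where f = sum]) auto
  also have "\<dots> = sum w ?S"
    by (rule sum.group) auto
  also have "\<dots> = (\<Sum>e \<in> in_arcs G v. w e * (of_bool (v = u) - of_bool (tail G e = u)))"
    using True by (intro sum.mono_neutral_cong_left) auto
  finally show ?thesis using True by (simp add: kirchhoff_entry_def sum_negf)
next
  case False
  have "total_weight w G u v = (\<Sum>e \<in> in_arcs G v. w e * of_bool (tail G e = u))"
    unfolding total_weight_def by (intro sum.mono_neutral_cong_left) auto
  then show ?thesis using False by (simp add: kirchhoff_entry_def sum_negf)
qed

section \<open>Choices of at most one incoming arc per vertex\<close>

locale numbered_digraph = fin_digraph G for G :: "(nat, 'b) pre_digraph" (structure) +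
  fixes n i j :: nat and w :: "'b weight_fun"
  assumes verts_G: "verts G = {1..n}" and i_in: "i \<in> verts G" and j_in: "j \<in> verts G"
begin

text \<open>Choice functions live on the matrix indices: index \<open>a\<close> belongs to vertex \<open>Suc a\<close>.\<close>

definition choices :: "nat \<Rightarrow> 'b option set" where
  "choices a = (if a = i - 1 then {None} else insert None (Some ` in_arcs G (Suc a)))"

text \<open>An extensional choice function is \<open>undefined\<close> outside its domain; the test
  \<open>a < n\<close> makes the indices there terminal.\<close>

definition parent :: "(nat \<Rightarrow> 'b option) \<Rightarrow> nat \<Rightarrow> nat option" where
  "parent c a = (if a < n then map_option (\<lambda>e. tail G e - 1) (c a) else None)"

definition graph_of :: "(nat \<Rightarrow> 'b option) \<Rightarrow> (nat, 'b) pre_digraph" where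
  "graph_of c = G\<lparr>arcs := {e \<in> arcs G. c (head G e - 1) = Some e}\<rparr>"

definition roots_of :: "(nat \<Rightarrow> 'b option) \<Rightarrow> nat set" where
  "roots_of c = {v \<in> verts G. c (v - 1) = None}"

text \<open>Meant as the inverse of the map from \<open>c\<close> to
  \<open>(graph_of c, roots_of c)\<close>. \<open>THE\<close> picks the only arc into a non-root,
  and the restriction makes the function extensional, as \<open>PiE\<close> demands.\<close>

definition choice_of :: "(nat, 'b) pre_digraph \<Rightarrow> nat set \<Rightarrow> nat \<Rightarrow> 'b option" where
  "choice_of H R = (\<lambda>a \<in> {0..<n}. if Suc a \<in> R then None
     else Some (THE e. e \<in> arcs H \<and> head G e = Suc a))"

lemma finite_choices: "finite (choices a)"
  by (simp add: choices_def finite_in_arcs)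

lemma ends_pos: "e \<in> arcs G \<Longrightarrow> 0 < tail G e \<and> tail G e \<le> n \<and> 0 < head G e \<and> head G e \<le> n"
  using head_in_verts[of e] tail_in_verts[of e] verts_G by auto

lemma graph_of_sel [simp]:
  "verts (graph_of c) = verts G" "tail (graph_of c) = tail G" "head (graph_of c) = head G"
  "arcs (graph_of c) = {e \<in> arcs G. c (head G e - 1) = Some e}"
  by (simp_all add: graph_of_def)

lemma wf_digraph_graph_of: "wf_digraph (graph_of c)"
  by unfold_locales auto

lemma spanning_graph_of: "spanning (graph_of c) G"
  using wf_digraph wf_digraph_graph_of by (auto simp: spanning_def subgraph_def compatible_def)

lemma choiceD:
  assumes "c \<in> PiE {0..<n} choices" "a < n" "c a = Some e"
  shows "e \<in> arcs G" "head G e = Suc a" "a \<noteq> i - 1"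
  using PiE_mem[OF assms(1), of a] assms(2,3) by (auto simp: choices_def split: if_splits)

lemma reachable_graph_of_iff:
  assumes c: "c \<in> PiE {0..<n} choices" and "a < n"
  shows "(a, b) \<in> {(a, b). parent c a = Some b}\<^sup>* \<longleftrightarrow> Suc b \<rightarrow>\<^sup>*\<^bsub>graph_of c\<^esub> Suc a"
proof
  interpret H: wf_digraph "graph_of c" by (rule wf_digraph_graph_of)
  show "Suc b \<rightarrow>\<^sup>*\<^bsub>graph_of c\<^esub> Suc a" if "(a, b) \<in> {(a, b). parent c a = Some b}\<^sup>*"
    using that \<open>a < n\<close>
  proof (induction rule: converse_rtrancl_induct)
    case base
    then show ?case by (intro H.reachable_refl) (simp add: verts_G)
  next
    case (step a d)
    then obtain e where e: "c a = Some e" "d = tail G e - 1"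
      by (auto simp: parent_def split: if_splits)
    with c step.prems have *: "e \<in> arcs G" "head G e = Suc a" by (auto dest: choiceD)
    with e ends_pos[of e] have "tail G e = Suc d" "d < n" by auto
    with * e have "Suc d \<rightarrow>\<^bsub>graph_of c\<^esub> Suc a" by (force simp: arcs_ends_conv)
    with step.IH \<open>d < n\<close> show ?case using H.reachable_adj_trans by blast
  qed
  have "(v - 1, u - 1) \<in> {(a, b). parent c a = Some b}\<^sup>*" if "u \<rightarrow>\<^sup>*\<^bsub>graph_of c\<^esub> v" for u v
    using that
  proof (induction rule: H.reachable_induct)
    case (step x y)
    then obtain e where "e \<in> arcs G" "c (y - 1) = Some e" "tail G e = x" "head G e = y"
      by (auto simp: arcs_ends_conv)
    then have "parent c (y - 1) = Some (x - 1)" using ends_pos[of e] by (auto simp: parent_def)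
    then show ?case using step.IH by (auto intro: converse_rtrancl_into_rtrancl)
  qed simp
  from this[of "Suc b" "Suc a"]
  show "Suc b \<rightarrow>\<^sup>*\<^bsub>graph_of c\<^esub> Suc a \<Longrightarrow> (a, b) \<in> {(a, b). parent c a = Some b}\<^sup>*"
    by simp
qed

text \<open>In \<open>graph_of c\<close> at most one arc enters each vertex and none enters a root,
  so only reachability from the roots remains. Indices outside the range are terminal by
  themselves.\<close>

lemma branching_graph_of_iff:
  assumes c: "c \<in> PiE {0..<n} choices"
  shows "branching (graph_of c) (roots_of c) \<longleftrightarrow>
    (\<forall>a. \<exists>r. parent c r = None \<and> (a, r) \<in> {(a, b). parent c a = Some b}\<^sup>*)"
proof -
  interpret H: wf_digraph "graph_of c" by (rule wf_digraph_graph_of)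
  have "branching (graph_of c) (roots_of c) \<longleftrightarrow>
      (\<forall>v \<in> verts G. \<exists>r \<in> roots_of c. r \<rightarrow>\<^sup>*\<^bsub>graph_of c\<^esub> v)"
  proof
    assume "branching (graph_of c) (roots_of c)"
    then interpret branching "graph_of c" "roots_of c" .
    show "\<forall>v \<in> verts G. \<exists>r \<in> roots_of c. r \<rightarrow>\<^sup>*\<^bsub>graph_of c\<^esub> v" using ex_root by simp
  next
    assume roots: "\<forall>v \<in> verts G. \<exists>r \<in> roots_of c. r \<rightarrow>\<^sup>*\<^bsub>graph_of c\<^esub> v"
    show "branching (graph_of c) (roots_of c)"
    proof unfold_locales
      fix e e' assume "e \<in> arcs (graph_of c)" "e' \<in> arcs (graph_of c)"
        "head (graph_of c) e = head (graph_of c) e'"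
      then have "Some e = Some e'" by (metis (mono_tags, lifting) graph_of_sel(3,4) mem_Collect_eq)
      then show "e = e'" by simp
    next
      show "\<exists>r \<in> roots_of c. r \<rightarrow>\<^sup>*\<^bsub>graph_of c\<^esub> v" if "v \<in> verts (graph_of c)" for v
        using that roots by simp
    qed (auto simp: roots_of_def)
  qed
  also have "\<dots> \<longleftrightarrow> (\<forall>a<n. \<exists>r<n. c r = None \<and> Suc r \<rightarrow>\<^sup>*\<^bsub>graph_of c\<^esub> Suc a)"
    (is "?L \<longleftrightarrow> ?R")
  proof
    assume ?L
    show ?R
    proof (intro allI impI)
      fix a assume "a < n"
      then have "Suc a \<in> verts G" by (simp add: verts_G)
      with \<open>?L\<close> obtain r where "r \<in> roots_of c" "r \<rightarrow>\<^sup>*\<^bsub>graph_of c\<^esub> Suc a" by blast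
      then show "\<exists>r<n. c r = None \<and> Suc r \<rightarrow>\<^sup>*\<^bsub>graph_of c\<^esub> Suc a"
        by (intro exI[of _ "r - 1"]) (auto simp: roots_of_def verts_G)
    qed
  next
    assume ?R
    show ?L
    proof
      fix v assume "v \<in> verts G"
      then have "v - 1 < n" "Suc (v - 1) = v" by (auto simp: verts_G)
      with \<open>?R\<close> obtain r where "r < n" "c r = None" "Suc r \<rightarrow>\<^sup>*\<^bsub>graph_of c\<^esub> v" by metis
      then show "\<exists>r \<in> roots_of c. r \<rightarrow>\<^sup>*\<^bsub>graph_of c\<^esub> v"
        by (intro bexI[of _ "Suc r"]) (auto simp: roots_of_def verts_G)
    qed
  qed
  also have "\<dots> \<longleftrightarrow> (\<forall>a<n. \<exists>r. parent c r = None \<and> Suc r \<rightarrow>\<^sup>*\<^bsub>graph_of c\<^esub> Suc a)"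
  proof -
    have "r < n" if "Suc r \<rightarrow>\<^sup>*\<^bsub>graph_of c\<^esub> Suc a" for r a
      using H.reachable_in_verts(1)[OF that] by (simp add: verts_G)
    then have "r < n \<and> c r = None \<and> Suc r \<rightarrow>\<^sup>*\<^bsub>graph_of c\<^esub> Suc a \<longleftrightarrow>
        parent c r = None \<and> Suc r \<rightarrow>\<^sup>*\<^bsub>graph_of c\<^esub> Suc a" for r a
      by (auto simp: parent_def)
    then show ?thesis by (simp only:)
  qed
  also have "\<dots> \<longleftrightarrow> (\<forall>a. \<exists>r. parent c r = None \<and> (a, r) \<in> {(a, b). parent c a = Some b}\<^sup>*)"
  proof -
    have "parent c a = None" if "\<not> a < n" for a using that by (simp add: parent_def)
    then show ?thesis using reachable_graph_of_iff[OF c] by (metis rtrancl.rtrancl_refl)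
  qed
  finally show ?thesis .
qed

text \<open>\<open>None\<close> contributes 1, and the other indices correspond to the arcs, each
  chosen at its own head.\<close>

lemma prod_weight_choice:
  assumes c: "c \<in> PiE {0..<n} choices"
  shows "(\<Prod>a = 0..<n. case c a of None \<Rightarrow> 1 | Some e \<Rightarrow> w e) = subgraph_weight w (graph_of c)"
proof -
  let ?f = "\<lambda>x. case x of None \<Rightarrow> 1 | Some e \<Rightarrow> w e"
  have "(\<Prod>a = 0..<n. ?f (c a)) = (\<Prod>a \<in> {a. a < n \<and> c a \<noteq> None}. ?f (c a))"
    by (intro prod.mono_neutral_right) auto
  also have "\<dots> = (\<Prod>e \<in> arcs (graph_of c). w e)"
    using c ends_pos
    by (intro prod.reindex_bij_witness[of _ "\<lambda>e. head G e - 1" "\<lambda>a. the (c a)"])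
      (fastforce dest: choiceD)+
  finally show ?thesis by (simp add: subgraph_weight_def)
qed

lemma choice_of_graph_of:
  assumes c: "c \<in> PiE {0..<n} choices"
  shows "choice_of (graph_of c) (roots_of c) = c"
proof
  fix a
  show "choice_of (graph_of c) (roots_of c) a = c a"
  proof (cases "a < n")
    case a: True
    show ?thesis
    proof (cases "c a")
      case None
      then show ?thesis using a by (simp add: choice_of_def roots_of_def verts_G)
    next
      case (Some e)
      then have "(THE e. e \<in> arcs (graph_of c) \<and> head G e = Suc a) = e"
        using choiceD[OF c a] by (intro the_equality) auto
      then show ?thesis using a Some by (simp add: choice_of_def roots_of_def)
    qed
  next
    case False
    then show ?thesis using PiE_arb[OF c, of a] by (simp add: choice_of_def)
  qed
qed

text \<open>Each non-root of \<open>H\<close> has exactly one incoming arc, so the pair is recovered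
  from its choice function. As \<open>i\<close> is a root, this function is \<open>None\<close> at
  \<open>i - 1\<close>, as \<open>choices\<close> prescribes.\<close>

lemma
  assumes H: "spanning H G" "branching H R" and i: "i \<in> R"
  shows choice_of_in: "choice_of H R \<in> PiE {0..<n} choices"
    and graph_of_choice_of: "graph_of (choice_of H R) = H"
    and roots_of_choice_of: "roots_of (choice_of H R) = R"
proof -
  interpret H: branching H R by (rule H(2))
  from H(1) have sel: "verts H = verts G" "tail H = tail G" "head H = head G" "arcs H \<subseteq> arcs G"
    by (auto simp: spanning_def subgraph_def compatible_def)
  have the: "(THE e'. e' \<in> arcs H \<and> head G e' = head G e) = e" if "e \<in> arcs H" for e
    using that H.arc_unique by (intro the_equality) (auto simp: sel)
  have choice_Some: "choice_of H R (head G e - 1) = Some e" if "e \<in> arcs H" for e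
  proof -
    have "head G e \<notin> R" using H.head_not_root[OF that] by (simp add: sel)
    moreover have "0 < head G e" "head G e \<le> n" using ends_pos[of e] that sel by auto
    ultimately show ?thesis using the[OF that] by (auto simp: choice_of_def)
  qed
  have ex: "\<exists>e \<in> arcs H. head G e = v \<and> choice_of H R (v - 1) = Some e"
    if "v \<in> verts G" "v \<notin> R" for v
    using H.ex_in_arc[of v] that choice_Some by (auto simp: sel)
  have none: "choice_of H R (v - 1) = None" if "v \<in> R" for v
    using H.root_in_verts[OF that] that by (auto simp: choice_of_def sel verts_G)
  show "choice_of H R \<in> PiE {0..<n} choices"
  proof (rule PiE_I)
    fix a assume "a \<in> {0..<n}"
    then have a: "Suc a \<in> verts G" by (simp add: verts_G)
    show "choice_of H R a \<in> choices a"
    proof (cases "Suc a \<in> R")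
      case True
      then show ?thesis using none[of "Suc a"] by (simp add: choices_def)
    next
      case False
      with i i_in have "a \<noteq> i - 1" by (auto simp: verts_G)
      with ex[OF a False] sel show ?thesis by (auto simp: choices_def)
    qed
  qed (simp add: choice_of_def)
  show "roots_of (choice_of H R) = R"
    using ex none H.root_in_verts by (fastforce simp: roots_of_def sel)
  have "arcs (graph_of (choice_of H R)) = arcs H"
  proof (intro equalityI subsetI)
    fix e assume e: "e \<in> arcs (graph_of (choice_of H R))"
    then have "head G e \<notin> R" using none by force
    with e ex[of "head G e"] show "e \<in> arcs H" by auto
  qed (use choice_Some sel in auto)
  then show "graph_of (choice_of H R) = H"
    by (intro pre_digraph.equality) (simp_all add: sel)
qed

lemma cofactor_eq_family_weight:
  defines "W \<equiv> 1\<^sub>m n + kirchhoff_mat w G"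
  shows "cofactor W (i - 1) (j - 1) = family_weight w (forests_from_to G i j)"
proof -
  let ?i = "i - 1" and ?j = "j - 1"
  let ?C = "PiE {0..<n} choices"
  let ?wt = "\<lambda>x. case x of None \<Rightarrow> 1 | Some e \<Rightarrow> w e"
  let ?y = "\<lambda>a x b. if a = ?i then of_bool (b = ?j)
    else of_bool (a = b) - of_bool (map_option (\<lambda>e. tail G e - 1) x = Some b) :: real"
  have ij: "?i < n" "?j < n" "Suc ?i = i" "Suc ?j = j"
    using i_in j_in by (auto simp: verts_G)
  have W: "W \<in> carrier_mat n n" by (simp add: W_def kirchhoff_mat_def verts_G)
  \<comment> \<open>The identity matrix supplies the term of \<open>None\<close>, with weight
    1.\<close>
  have entry: "W $$ (a, b) = (\<Sum>x \<in> choices a. ?wt x * ?y a x b)"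
    if "a < n" "b < n" "a \<noteq> ?i" for a b
  proof -
    have "W $$ (a, b) = of_bool (a = b) +
        (\<Sum>e \<in> in_arcs G (Suc a). w e * (of_bool (a = b) - of_bool (tail G e = Suc b)))"
      using that by (simp add: W_def kirchhoff_mat_def verts_G kirchhoff_entry_eq)
    also have "(\<Sum>e \<in> in_arcs G (Suc a). w e * (of_bool (a = b) - of_bool (tail G e = Suc b))) =
        (\<Sum>x \<in> Some ` in_arcs G (Suc a). ?wt x * ?y a x b)"
    proof -
      \<comment> \<open>Truncated subtraction is harmless because tails are at least 1.\<close>
      have "tail G e - 1 = b \<longleftrightarrow> tail G e = Suc b" if "e \<in> arcs G" for e
        using ends_pos[OF that] by auto
      then show ?thesis
        using that by (subst sum.reindex) (auto intro!: sum.cong)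
    qed
    also have "of_bool (a = b) + \<dots> = (\<Sum>x \<in> choices a. ?wt x * ?y a x b)"
      using that finite_in_arcs[of "Suc a"] by (subst choices_def) (simp add: sum.insert_if)
    finally show ?thesis .
  qed
  have "cofactor W ?i ?j =
      det (mat n n (\<lambda>(a, b). if a = ?i then of_bool (b = ?j) else W $$ (a, b)))"
    using W ij by (intro cofactor_eq_det_replace_row) auto
  also have "mat n n (\<lambda>(a, b). if a = ?i then of_bool (b = ?j) else W $$ (a, b)) =
      mat n n (\<lambda>(a, b). \<Sum>x \<in> choices a. ?wt x * ?y a x b)"
  proof (rule cong_mat[OF refl refl])
    fix a b assume "a < n" "b < n"
    then show "(case (a, b) of (a, b) \<Rightarrow> if a = ?i then of_bool (b = ?j) else W $$ (a, b)) =
        (case (a, b) of (a, b) \<Rightarrow> \<Sum>x \<in> choices a. ?wt x * ?y a x b)"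
      \<comment> \<open>At index \<open>i - 1\<close> the only option is \<open>None\<close>, of
        weight 1, so the sum is the unit row.\<close>
      using entry[of a b] by (cases "a = ?i") (simp_all add: choices_def)
  qed
  also have "det \<dots> = (\<Sum>c \<in> ?C. (\<Prod>a = 0..<n. ?wt (c a)) * det (mat n n (\<lambda>(a, b). ?y a (c a) b)))"
    by (rule det_eq_sum_over_row_choices) (rule finite_choices)
  also have "\<dots> = (\<Sum>c \<in> ?C. if branching (graph_of c) (roots_of c) \<and> i \<rightarrow>\<^sup>*\<^bsub>graph_of c\<^esub> j
      then subgraph_weight w (graph_of c) else 0)"
  proof (rule sum.cong[OF refl])
    fix c assume c: "c \<in> ?C"
    have "mat n n (\<lambda>(a, b). ?y a (c a) b) = link_mat n ?i ?j (parent c)"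
      by (auto simp: link_mat_def parent_def intro!: cong_mat)
    also have "det \<dots> = of_bool ((?j, ?i) \<in> {(a, b). parent c a = Some b}\<^sup>* \<and>
        (\<forall>a. \<exists>r. parent c r = None \<and> (a, r) \<in> {(a, b). parent c a = Some b}\<^sup>*))"
    proof (rule det_link_mat[OF ij(1,2)])
      show "parent c ?i = None"
        using PiE_mem[OF c, of ?i] ij by (simp add: choices_def parent_def)
      show "a < n \<and> b < n" if "parent c a = Some b" for a b
      proof -
        from that obtain e where e: "a < n" "c a = Some e" "b = tail G e - 1"
          by (auto simp: parent_def split: if_splits)
        then show ?thesis using choiceD(1)[OF c] ends_pos[of e] by fastforce
      qed
    qed
    also have "\<dots> = of_bool (i \<rightarrow>\<^sup>*\<^bsub>graph_of c\<^esub> j \<and> branching (graph_of c) (roots_of c))"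
      using reachable_graph_of_iff[OF c ij(2)] branching_graph_of_iff[OF c] ij by simp
    finally show "(\<Prod>a = 0..<n. ?wt (c a)) * det (mat n n (\<lambda>(a, b). ?y a (c a) b)) =
        (if branching (graph_of c) (roots_of c) \<and> i \<rightarrow>\<^sup>*\<^bsub>graph_of c\<^esub> j
         then subgraph_weight w (graph_of c) else 0)"
      using prod_weight_choice[OF c] by auto
  qed
  also have "\<dots> = (\<Sum>c \<in> {c \<in> ?C. branching (graph_of c) (roots_of c) \<and>
      i \<rightarrow>\<^sup>*\<^bsub>graph_of c\<^esub> j}. subgraph_weight w (graph_of c))"
    by (rule sum.inter_filter[symmetric]) (simp add: finite_PiE finite_choices)
  also have "\<dots> = family_weight w (forests_from_to G i j)"
    unfolding family_weight_def forests_from_to_eq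
  proof (rule sum.reindex_bij_witness[of _ "\<lambda>(H, R). choice_of H R"
        "\<lambda>c. (graph_of c, roots_of c)"], goal_cases)
    case (2 c)
    \<comment> \<open>That \<open>i\<close> is a root is not part of the filter; it follows because
      \<open>None\<close> is the only choice at \<open>i - 1\<close>.\<close>
    then have "c ?i = None" using PiE_mem[of c "{0..<n}" choices ?i] ij by (simp add: choices_def)
    with 2 i_in show ?case by (simp add: spanning_graph_of roots_of_def)
  qed (simp_all add: split_paired_all choice_of_graph_of choice_of_in graph_of_choice_of roots_of_choice_of)
  finally show ?thesis .
qed

end

theorem theorem4:
  fixes \<Gamma> :: "(nat, 'b) pre_digraph" and w :: "'b weight_fun"
    and W :: "real mat" and n i j :: nat
  assumes "fin_digraph \<Gamma>"
    and "verts \<Gamma> = {1..n}"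
    and "W = 1\<^sub>m n + kirchhoff_mat w \<Gamma>"
    and "i \<in> verts \<Gamma>" and "j \<in> verts \<Gamma>"
  shows "cofactor W (i - 1) (j - 1) = family_weight w (forests_from_to \<Gamma> i j)"
proof -
  interpret numbered_digraph \<Gamma> n i j w
    using assms by (simp add: numbered_digraph_def numbered_digraph_axioms_def)
  show ?thesis using cofactor_eq_family_weight assms(3) by simp
qed

end
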